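(* Let $\gamma:\mathbb{S}\to\mathbb{R}^2$ be a rescaling (by a positive constant factor) of the figure eight curve $$u\mapsto\frac{1}{1+\sin^2u}\left(\cos u,\ \tfrac12\sin 2u\right)$$ chosen such that $\gamma$ has length $L(\gamma)=1$. Then the homothetic solution to the curve diffusion flow with initial data $\gamma$ shrinks self-similarly to a point at the time $$T=\frac{1}{3\cdot2^{11}\cdot\mathcal{K}(-1)^4},$$ where $\mathcal{K}(m)$ is the complete elliptic integral of the first kind with parameter $m=k^2$.
   Context: $\mathbb{S}=\mathbb{R}/2\pi\mathbb{Z}$. For a smooth regular plane curve, $s$ is arc length, $\nu$ a smooth unit normal field, and $\kappa=\langle\gamma_{ss},\nu\rangle$. A family of curves $\gamma(\cdot,t)$ evolves by the curve diffusion flow if $\langle\partial_t\gamma,\nu\rangle=-\kappa_{ss}$ (the flow is considered up to tangential reparametrisation). A homothetic solution with initial data $\gamma$ is one of the form $\gamma(u,t)=f(t)\gamma(u)$ with $f$ positive and differentiable on $[0,T)$, $f(0)=1$; it shrinks to a point at time $T$ if $f(t)\to0$ as $t\nearrow T$. $\mathcal{K}(m)=\int_0^{\pi/2}\frac{d\theta}{\sqrt{1-m\sin^2\theta}}$. *)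

theory Defs
  imports "HOL-Analysis.Analysis"
begin

text \<open>
  Maps on \<open>S = R / 2 pi Z\<close> are represented by \<open>2 pi\<close>-periodic maps on the real line, and the
  plane is the Euclidean space \<^typ>\<open>real \<times> real\<close>.
\<close>

abbreviation vderiv :: "(real \<Rightarrow> 'a::real_normed_vector) \<Rightarrow> real \<Rightarrow> 'a" where
  "vderiv f \<equiv> (\<lambda>u. vector_derivative f (at u))"

definition smooth :: "(real \<Rightarrow> 'a::real_normed_vector) \<Rightarrow> bool" where
  "smooth f \<longleftrightarrow> (\<forall>n u. (vderiv ^^ n) f differentiable (at u))"

definition periodic_2pi :: "(real \<Rightarrow> 'a) \<Rightarrow> bool" where
  "periodic_2pi f \<longleftrightarrow> (\<forall>u. f (u + 2 * pi) = f u)"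

definition closed_curve :: "(real \<Rightarrow> real \<times> real) \<Rightarrow> bool" where
  "closed_curve \<gamma> \<longleftrightarrow> smooth \<gamma> \<and> periodic_2pi \<gamma> \<and> (\<forall>u. vderiv \<gamma> u \<noteq> 0)"

definition curve_length :: "(real \<Rightarrow> real \<times> real) \<Rightarrow> real" where
  "curve_length \<gamma> = integral {0..2 * pi} (\<lambda>u. norm (vderiv \<gamma> u))"

text \<open>Derivative with respect to the arc length \<open>s\<close> of \<open>\<gamma>\<close>, in terms of the parameter \<open>u\<close>.\<close>

definition arc_deriv ::
    "(real \<Rightarrow> real \<times> real) \<Rightarrow> (real \<Rightarrow> 'a::real_normed_vector) \<Rightarrow> real \<Rightarrow> 'a" where
  "arc_deriv \<gamma> F u = vderiv F u /\<^sub>R norm (vderiv \<gamma> u)"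

definition unit_normal_field ::
    "(real \<Rightarrow> real \<times> real) \<Rightarrow> (real \<Rightarrow> real \<times> real) \<Rightarrow> bool" where
  "unit_normal_field \<gamma> \<nu> \<longleftrightarrow>
     smooth \<nu> \<and> periodic_2pi \<nu> \<and> (\<forall>u. norm (\<nu> u) = 1 \<and> \<nu> u \<bullet> vderiv \<gamma> u = 0)"

definition curvature ::
    "(real \<Rightarrow> real \<times> real) \<Rightarrow> (real \<Rightarrow> real \<times> real) \<Rightarrow> real \<Rightarrow> real" where
  "curvature \<gamma> \<nu> u = arc_deriv \<gamma> (arc_deriv \<gamma> \<gamma>) u \<bullet> \<nu> u"

text \<open>
  Only the normal velocity is prescribed, so the notion does not depend on tangential
  reparametrisations. A smooth regular closed curve has exactly two unit normal fields,
  differing by a sign, and the equation is invariant under this change of sign; hence the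
  choice of \<open>\<nu>\<close> is immaterial. At \<open>t = 0\<close> the time derivative is one-sided.
\<close>

definition curve_diffusion_flow :: "real \<Rightarrow> (real \<Rightarrow> real \<Rightarrow> real \<times> real) \<Rightarrow> bool" where
  "curve_diffusion_flow T \<Gamma> \<longleftrightarrow>
     (\<forall>t\<in>{0..<T}.
        closed_curve (\<lambda>u. \<Gamma> u t) \<and>
        (\<exists>\<nu>. unit_normal_field (\<lambda>u. \<Gamma> u t) \<nu> \<and>
           (\<forall>u. \<exists>V. ((\<lambda>\<tau>. \<Gamma> u \<tau>) has_vector_derivative V) (at t within {0..<T}) \<and>
              V \<bullet> \<nu> u =
                - arc_deriv (\<lambda>u. \<Gamma> u t)
                    (arc_deriv (\<lambda>u. \<Gamma> u t) (curvature (\<lambda>u. \<Gamma> u t) \<nu>)) u)))"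

definition homothetic_solution ::
    "(real \<Rightarrow> real \<times> real) \<Rightarrow> real \<Rightarrow> (real \<Rightarrow> real) \<Rightarrow> bool" where
  "homothetic_solution \<gamma> T f \<longleftrightarrow>
     0 < T \<and> f 0 = 1 \<and>
     (\<forall>t\<in>{0..<T}. 0 < f t \<and> f differentiable (at t within {0..<T})) \<and>
     curve_diffusion_flow T (\<lambda>u t. f t *\<^sub>R \<gamma> u)"

definition shrinks_to_point_at :: "real \<Rightarrow> (real \<Rightarrow> real) \<Rightarrow> bool" where
  "shrinks_to_point_at T f \<longleftrightarrow> (f \<longlongrightarrow> 0) (at_left T)"

definition figure_eight :: "real \<Rightarrow> real \<times> real" where
  "figure_eight u = (1 / (1 + (sin u)\<^sup>2)) *\<^sub>R (cos u, 1 / 2 * sin (2 * u))"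

definition elliptic_K :: "real \<Rightarrow> real" where
  "elliptic_K m = integral {0..pi / 2} (\<lambda>\<theta>. 1 / sqrt (1 - m * (sin \<theta>)\<^sup>2))"

end

theory Submission imports Defs
begin

text \<open>
  Write \<open>r = 1 / sqrt (1 + sin\<^sup>2 u)\<close>. In complex notation the figure eight is \<open>cos u / (1 - i sin u)\<close>,
  its speed is \<open>r\<close> and its unit tangent is \<open>i (1 + i sin u)\<^sup>3 r\<^sup>3\<close>. Hence \<open>\<kappa> = 3 r cos u\<close> and
  \<open>\<kappa>\<^sub>s\<^sub>s = - 6 (r cos u)\<^sup>3\<close>, which is six times the support function \<open>\<langle>\<gamma>, \<nu>\<rangle>\<close>. A rescaling by \<open>c\<close>
  therefore moves homothetically with factor \<open>f\<close> if and only if \<open>f' = - 6 / (c\<^sup>4 f\<^sup>3)\<close>, that is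
  \<open>f\<^sup>4 = 1 - 24 t / c\<^sup>4\<close>. Finally the length of the figure eight is \<open>4 K(-1)\<close>.
\<close>

section \<open>Smoothness via classes of functions closed under differentiation\<close>

lemma vderiv_eqI:
  "(\<And>u. (f has_vector_derivative f' u) (at u)) \<Longrightarrow> vderiv f = f'"
  by (auto intro: vector_derivative_at)

lemma smooth_imp_differentiable: "smooth f \<Longrightarrow> f differentiable (at u)"
  unfolding smooth_def by (metis funpow_0)

text \<open>By induction on n the iterated derivatives never leave \<open>P\<close>, so smoothness
  follows without a formula for the n-th derivative.\<close>

lemma smooth_coinduct:
  assumes "P f"
    and "\<And>f. P f \<Longrightarrow> \<exists>f'. P f' \<and> (\<forall>u. (f has_vector_derivative f' u) (at u))"
  shows "smooth f"
proof -
  have "P ((vderiv ^^ n) f)" for n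
  proof (induction n)
    case (Suc n)
    then show ?case using assms(2) vderiv_eqI by fastforce
  qed (simp add: assms(1))
  then show ?thesis
    unfolding smooth_def using assms(2) differentiableI_vector by blast
qed

section \<open>The function r, here \<open>recip_w\<close>, and the algebra it generates with sine
  and cosine\<close>

definition recip_w :: "real \<Rightarrow> real" where
  "recip_w u = 1 / sqrt (1 + (sin u)\<^sup>2)"

lemma recip_w_pos: "0 < recip_w u"
  unfolding recip_w_def by (simp add: add_pos_nonneg)

text \<open>Modulo this relation and sin^2 + cos^2 = 1 the later identities are polynomial, so
  \<open>algebra\<close> can decide them without seeing the square root.\<close>

lemma recip_w_sq: "(recip_w u)\<^sup>2 * (1 + (sin u)\<^sup>2) = 1"
proof -
  have "0 < 1 + (sin u)\<^sup>2" by (simp add: add_pos_nonneg)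
  then show ?thesis unfolding recip_w_def by (simp add: power_divide)
qed

text \<open>The derivative is again a polynomial in \<open>sin\<close>, \<open>cos\<close> and
  \<open>recip_w\<close>, which is why \<open>trig_alg\<close> is closed under
  differentiation.\<close>

lemma recip_w_deriv:
  "(recip_w has_real_derivative - (sin u * cos u * recip_w u ^ 3)) (at u)"
proof -
  have pos: "0 < 1 + (sin u)\<^sup>2" by (simp add: add_pos_nonneg)
  have "sqrt (1 + (sin u)\<^sup>2) ^ 3 = (1 + (sin u)\<^sup>2) * sqrt (1 + (sin u)\<^sup>2)"
    using pos by (simp add: power3_eq_cube)
  with pos show ?thesis unfolding recip_w_def [abs_def]
    by (auto intro!: derivative_eq_intros simp: power_divide divide_simps power2_eq_square)
qed

text \<open>The real algebra generated by \<open>sin\<close>, \<open>cos\<close> and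
  \<open>recip_w\<close>. The coordinates of the curve and of its normal lie in it, hence are
  smooth.\<close>

inductive trig_alg :: "(real \<Rightarrow> real) \<Rightarrow> bool" where
  const: "trig_alg (\<lambda>u. a)"
| sin: "trig_alg sin"
| cos: "trig_alg cos"
| recip_w: "trig_alg recip_w"
| add: "trig_alg f \<Longrightarrow> trig_alg g \<Longrightarrow> trig_alg (\<lambda>u. f u + g u)"
| mult: "trig_alg f \<Longrightarrow> trig_alg g \<Longrightarrow> trig_alg (\<lambda>u. f u * g u)"

lemma trig_alg_minus: "trig_alg f \<Longrightarrow> trig_alg (\<lambda>u. - f u)"
  using trig_alg.mult [OF trig_alg.const [of "-1"]] by simp

lemma trig_alg_diff: "trig_alg f \<Longrightarrow> trig_alg g \<Longrightarrow> trig_alg (\<lambda>u. f u - g u)"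
  using trig_alg.add [OF _ trig_alg_minus] by simp

lemma trig_alg_power: "trig_alg f \<Longrightarrow> trig_alg (\<lambda>u. f u ^ n)"
  by (induction n) (auto intro: trig_alg.intros)

lemmas trig_alg_intros = trig_alg.intros trig_alg_minus trig_alg_diff trig_alg_power

lemma trig_alg_deriv:
  assumes "trig_alg f"
  shows "\<exists>f'. trig_alg f' \<and> (\<forall>u. (f has_real_derivative f' u) (at u))"
  using assms
proof induction
  case (const a)
  show ?case by (rule exI [of _ "\<lambda>u. 0"]) (auto intro: trig_alg_intros)
next
  case sin
  show ?case by (rule exI [of _ cos]) (auto intro: trig_alg_intros DERIV_sin)
next
  case cos
  show ?case by (rule exI [of _ "\<lambda>u. - sin u"]) (auto intro: trig_alg_intros DERIV_cos)
next
  case recip_w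
  show ?case
    by (intro exI [of _ "\<lambda>u. - (sin u * cos u * recip_w u ^ 3)"] conjI allI
        recip_w_deriv trig_alg_intros)
next
  case (add f g)
  then obtain f' g' where "trig_alg f'" "trig_alg g'"
    "\<And>u. (f has_real_derivative f' u) (at u)" "\<And>u. (g has_real_derivative g' u) (at u)"
    by blast
  then show ?case
    by (intro exI [of _ "\<lambda>u. f' u + g' u"]) (auto intro: trig_alg_intros DERIV_add)
next
  case (mult f g)
  then obtain f' g' where "trig_alg f'" "trig_alg g'"
    "\<And>u. (f has_real_derivative f' u) (at u)" "\<And>u. (g has_real_derivative g' u) (at u)"
    by blast
  with mult.hyps show ?case
    by (intro exI [of _ "\<lambda>u. f' u * g u + g' u * f u"]) (auto intro: trig_alg_intros DERIV_mult)
qed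

lemma trig_alg_smooth_Pair:
  assumes "trig_alg f" "trig_alg g"
  shows "smooth (\<lambda>u. (f u, g u))"
proof (rule smooth_coinduct
    [of "\<lambda>F. \<exists>f g. trig_alg f \<and> trig_alg g \<and> F = (\<lambda>u. (f u, g u))"], goal_cases)
  case 1
  then show ?case using assms by blast
next
  case (2 F)
  then obtain f g where fg: "trig_alg f" "trig_alg g" and F: "F = (\<lambda>u. (f u, g u))"
    by blast
  obtain f' g' where "trig_alg f'" "trig_alg g'"
    "\<And>u. (f has_vector_derivative f' u) (at u)" "\<And>u. (g has_vector_derivative g' u) (at u)"
    using trig_alg_deriv [OF fg(1)] trig_alg_deriv [OF fg(2)]
    by (auto simp: has_real_derivative_iff_has_vector_derivative)
  then show ?case
    unfolding F
    by (intro exI [of _ "\<lambda>u. (f' u, g' u)"]) (auto intro: has_vector_derivative_Pair)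
qed

section \<open>Moving frame of the figure eight\<close>

definition fig_tangent :: "real \<Rightarrow> real \<times> real" where
  "fig_tangent u =
     (- (3 * sin u - sin u ^ 3) * recip_w u ^ 3, (1 - 3 * sin u ^ 2) * recip_w u ^ 3)"

text \<open>The tangent multiplied by i, that is -(1 + i sin u)^3 r^3.\<close>

definition fig_normal :: "real \<Rightarrow> real \<times> real" where
  "fig_normal u =
     (- (1 - 3 * sin u ^ 2) * recip_w u ^ 3, - (3 * sin u - sin u ^ 3) * recip_w u ^ 3)"

text \<open>Turns powers with numeral exponents, including the exponents n - 1 left by the power
  rule, into products that \<open>algebra\<close> can treat.\<close>

lemmas expand_powers =
  numeral_2_eq_2 numeral_3_eq_3 diff_Suc_Suc diff_zero of_nat_Suc of_nat_0 power_Suc power_0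

lemma figure_eight_eq:
  "figure_eight u = (cos u * recip_w u ^ 2, sin u * cos u * recip_w u ^ 2)"
proof -
  have "1 / (1 + (sin u)\<^sup>2) = recip_w u ^ 2"
    using recip_w_sq [of u] by (metis nonzero_mult_div_cancel_right mult_eq_0_iff zero_neq_one)
  then show ?thesis unfolding figure_eight_def by (simp add: sin_double)
qed

text \<open>The derivative of cos u / (1 - i sin u) is i (1 + i sin u) / (1 - i sin u)^2, and 1 / (1
  - i sin u) = (1 + i sin u) r^2.\<close>

lemma has_vector_derivative_figure_eight:
  "(figure_eight has_vector_derivative recip_w u *\<^sub>R fig_tangent u) (at u)"
proof -
  note rel = recip_w_sq [of u] sin_cos_squared_add [of u]
  have 1: "((\<lambda>u. cos u * recip_w u ^ 2) has_real_derivative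
      recip_w u * (- (3 * sin u - sin u ^ 3) * recip_w u ^ 3)) (at u)"
    by (rule derivative_eq_intros recip_w_deriv refl)+ (simp only: expand_powers, use rel in algebra)
  have 2: "((\<lambda>u. sin u * cos u * recip_w u ^ 2) has_real_derivative
      recip_w u * ((1 - 3 * sin u ^ 2) * recip_w u ^ 3)) (at u)"
    by (rule derivative_eq_intros recip_w_deriv refl)+ (simp only: expand_powers, use rel in algebra)
  show ?thesis
    unfolding figure_eight_eq [abs_def] fig_tangent_def
    using has_vector_derivative_Pair
      [OF 1 [unfolded has_real_derivative_iff_has_vector_derivative]
          2 [unfolded has_real_derivative_iff_has_vector_derivative]]
    by simp
qed

text \<open>The tangent has polar angle pi/2 + 3 arctan (sin u), whose derivative is 3 cos u
  r^2.\<close>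

lemma has_vector_derivative_fig_tangent:
  "(fig_tangent has_vector_derivative (3 * cos u * recip_w u ^ 2) *\<^sub>R fig_normal u) (at u)"
proof -
  note rel = recip_w_sq [of u] sin_cos_squared_add [of u]
  have 1: "((\<lambda>u. - (3 * sin u - sin u ^ 3) * recip_w u ^ 3) has_real_derivative
      3 * cos u * recip_w u ^ 2 * (- (1 - 3 * sin u ^ 2) * recip_w u ^ 3)) (at u)"
    by (rule derivative_eq_intros recip_w_deriv refl)+ (simp only: expand_powers, use rel in algebra)
  have 2: "((\<lambda>u. (1 - 3 * sin u ^ 2) * recip_w u ^ 3) has_real_derivative
      3 * cos u * recip_w u ^ 2 * (- (3 * sin u - sin u ^ 3) * recip_w u ^ 3)) (at u)"
    by (rule derivative_eq_intros recip_w_deriv refl)+ (simp only: expand_powers, use rel in algebra)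
  show ?thesis
    unfolding fig_normal_def fig_tangent_def [abs_def]
    using has_vector_derivative_Pair
      [OF 1 [unfolded has_real_derivative_iff_has_vector_derivative]
          2 [unfolded has_real_derivative_iff_has_vector_derivative]]
    by simp
qed

text \<open>The last identity is the support function: the real part of (1 - i sin u) (1 + i sin
  u)^3 is r^(-2) (1 - sin^2 u), and 1 - sin^2 u = cos^2 u.\<close>

lemma fig_frame:
  "fig_tangent u \<bullet> fig_tangent u = 1" "fig_normal u \<bullet> fig_normal u = 1"
  "fig_normal u \<bullet> fig_tangent u = 0"
  "figure_eight u \<bullet> fig_normal u = - ((cos u * recip_w u) ^ 3)"
proof -
  note rel = recip_w_sq [of u] sin_cos_squared_add [of u]
  show "fig_normal u \<bullet> fig_tangent u = 0"
    unfolding fig_normal_def fig_tangent_def inner_Pair inner_real_def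
    by (simp add: algebra_simps)
  show "fig_tangent u \<bullet> fig_tangent u = 1" "fig_normal u \<bullet> fig_normal u = 1"
    unfolding fig_normal_def fig_tangent_def inner_Pair inner_real_def using rel by algebra+
  show "figure_eight u \<bullet> fig_normal u = - ((cos u * recip_w u) ^ 3)"
    unfolding fig_normal_def figure_eight_eq inner_Pair inner_real_def using rel by algebra
qed

lemma fig_norms: "norm (fig_tangent u) = 1" "norm (fig_normal u) = 1"
  by (simp_all add: norm_eq_sqrt_inner fig_frame)

section \<open>Unit normals and curvature of the rescaled curves\<close>

lemma smooth_scaled_figure_eight: "smooth (\<lambda>u. a *\<^sub>R figure_eight u)"
  unfolding figure_eight_eq scaleR_Pair real_scaleR_def
  by (intro trig_alg_smooth_Pair trig_alg_intros)

lemma smooth_fig_normal: "smooth fig_normal"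
  unfolding fig_normal_def [abs_def] by (intro trig_alg_smooth_Pair trig_alg_intros)

lemma vderiv_scaled_figure_eight:
  "vderiv (\<lambda>u. a *\<^sub>R figure_eight u) u = (a * recip_w u) *\<^sub>R fig_tangent u"
proof -
  have "((\<lambda>u. a *\<^sub>R figure_eight u) has_vector_derivative a *\<^sub>R recip_w u *\<^sub>R fig_tangent u) (at u)"
    by (rule bounded_linear.has_vector_derivative
        [OF bounded_linear_scaleR_right has_vector_derivative_figure_eight])
  then show ?thesis by (simp add: vector_derivative_at)
qed

lemma speed_scaled_figure_eight:
  assumes "0 < a"
  shows "norm (vderiv (\<lambda>u. a *\<^sub>R figure_eight u) u) = a * recip_w u"
  using assms recip_w_pos [of u] by (simp add: vderiv_scaled_figure_eight fig_norms)

lemma arc_deriv_scaled_figure_eight: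
  assumes "0 < a" "(F has_vector_derivative F') (at u)"
  shows "arc_deriv (\<lambda>u. a *\<^sub>R figure_eight u) F u = F' /\<^sub>R (a * recip_w u)"
  unfolding arc_deriv_def speed_scaled_figure_eight [OF assms(1)]
  using assms(2) by (simp add: vector_derivative_at)

lemma periodic_trig:
  "recip_w (u + 2 * pi) = recip_w u" "fig_normal (u + 2 * pi) = fig_normal u"
  "figure_eight (u + 2 * pi) = figure_eight u"
  by (simp_all add: recip_w_def fig_normal_def figure_eight_eq)

lemma closed_curve_scaled_figure_eight:
  assumes "0 < a"
  shows "closed_curve (\<lambda>u. a *\<^sub>R figure_eight u)"
proof -
  have "fig_tangent u \<noteq> 0" for u using fig_norms(1) [of u] by auto
  then show ?thesis
    using assms recip_w_pos less_irrefl unfolding closed_curve_def periodic_2pi_def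
    by (auto simp: smooth_scaled_figure_eight periodic_trig vderiv_scaled_figure_eight
        simp flip: scaleR_scaleR) (metis less_irrefl)
qed

lemma unit_normal_field_fig_normal:
  "unit_normal_field (\<lambda>u. a *\<^sub>R figure_eight u) fig_normal"
  unfolding unit_normal_field_def periodic_2pi_def
  by (simp add: smooth_fig_normal periodic_trig vderiv_scaled_figure_eight fig_frame fig_norms)

text \<open>The flow only asserts that some normal field exists; this pins it down up to a global
  sign. Pointwise \<nu> is plus or minus \<open>fig_normal\<close>, and by continuity the sign
  cannot change.\<close>

lemma unit_normal_field_unique:
  assumes "0 < a" "unit_normal_field (\<lambda>u. a *\<^sub>R figure_eight u) \<nu>"
  obtains \<sigma> where "\<sigma>\<^sup>2 = 1" "\<And>u. \<nu> u = \<sigma> *\<^sub>R fig_normal u"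
proof -
  let ?\<sigma> = "\<lambda>u. \<nu> u \<bullet> fig_normal u"
  have unit: "\<nu> u \<bullet> \<nu> u = 1" and orth: "\<nu> u \<bullet> fig_tangent u = 0" for u
    using assms recip_w_pos [THEN less_imp_neq] unfolding unit_normal_field_def
    by (auto simp: vderiv_scaled_figure_eight norm_eq_1 dest: not_sym)
  have eq: "\<nu> u = ?\<sigma> u *\<^sub>R fig_normal u" for u
  proof (cases "\<nu> u")
    case (Pair x y)
    \<comment> \<open>Expansion of \<nu> in the orthonormal frame, where the tangential coefficient
      vanishes.\<close>
    have "x = ?\<sigma> u * fst (fig_normal u) \<and> y = ?\<sigma> u * snd (fig_normal u)"
      using orth [of u] recip_w_sq [of u]
      unfolding Pair fig_normal_def fig_tangent_def inner_Pair inner_real_def fst_conv snd_conv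
      by algebra
    then show ?thesis by (simp add: Pair prod_eq_iff)
  qed
  have sq: "(?\<sigma> u)\<^sup>2 = 1" for u
    using unit [of u] eq [of u] fig_frame(2) [of u]
    by (metis inner_scaleR_left inner_scaleR_right mult.right_neutral power2_eq_square)
  \<comment> \<open>A continuous function with finite range on the connected line is
    constant.\<close>
  have "continuous_on UNIV ?\<sigma>"
    using assms(2) smooth_fig_normal unfolding unit_normal_field_def
    by (intro continuous_on_inner continuous_at_imp_continuous_on ballI
        differentiable_imp_continuous_within smooth_imp_differentiable) auto
  moreover have "range ?\<sigma> \<subseteq> {1, -1}" using sq by (auto simp: power2_eq_1_iff)
  then have "finite (range ?\<sigma>)" by (rule finite_subset) simp
  ultimately obtain k where "\<And>u. ?\<sigma> u = k"
    using continuous_finite_range_constant [of UNIV ?\<sigma>] by (auto simp: constant_on_def)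
  then show ?thesis using that [of k] eq sq by metis
qed

text \<open>The turning rate 3 cos u r^2 of the tangent is divided by the speed a r.\<close>

lemma curvature_scaled_figure_eight:
  assumes "0 < a"
  shows "curvature (\<lambda>u. a *\<^sub>R figure_eight u) (\<lambda>u. \<sigma> *\<^sub>R fig_normal u) u =
    \<sigma> * (3 * cos u * recip_w u / a)"
proof -
  have "arc_deriv (\<lambda>u. a *\<^sub>R figure_eight u) (\<lambda>u. a *\<^sub>R figure_eight u) = fig_tangent"
  proof
    fix u
    show "arc_deriv (\<lambda>u. a *\<^sub>R figure_eight u) (\<lambda>u. a *\<^sub>R figure_eight u) u = fig_tangent u"
      using assms recip_w_pos [of u]
      by (simp add: arc_deriv_def speed_scaled_figure_eight vderiv_scaled_figure_eight fig_norms
          field_simps)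
  qed
  then show ?thesis
    using assms recip_w_pos [of u]
    by (simp add: curvature_def arc_deriv_scaled_figure_eight
        [OF assms has_vector_derivative_fig_tangent] fig_frame field_simps power2_eq_square)
qed

text \<open>The identity behind self-similarity: \<kappa>_ss is proportional to the support
  function. Curvature and the two arc length derivatives contribute one factor 1 / a each. Both
  sides are linear in \<sigma>, so either normal is covered.\<close>

lemma curvature_ss_scaled_figure_eight:
  assumes "0 < a"
  defines "\<gamma> \<equiv> \<lambda>u. a *\<^sub>R figure_eight u"
  shows "arc_deriv \<gamma> (arc_deriv \<gamma> (curvature \<gamma> (\<lambda>u. \<sigma> *\<^sub>R fig_normal u))) u =
    6 / a ^ 3 * (figure_eight u \<bullet> (\<sigma> *\<^sub>R fig_normal u))"
proof -
  note arc_deriv = arc_deriv_scaled_figure_eight [OF assms(1), folded \<gamma>_def]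
  have 1: "((\<lambda>u. \<sigma> * (3 * cos u * recip_w u / a)) has_real_derivative
      - 6 * \<sigma> / a * (sin u * recip_w u ^ 3)) (at u)" for u
  proof -
    \<comment> \<open>Taking out - sin u r^3 leaves 1 / r^2 + cos^2 u = 1 + sin^2 u + cos^2 u =
      2.\<close>
    have "- sin u * recip_w u - sin u * cos u * recip_w u ^ 3 * cos u = - 2 * (sin u * recip_w u ^ 3)"
      using recip_w_sq [of u] sin_cos_squared_add [of u] by algebra
    moreover have "((\<lambda>u. cos u * recip_w u) has_real_derivative
        - sin u * recip_w u - sin u * cos u * recip_w u ^ 3 * cos u) (at u)"
      by (auto intro!: derivative_eq_intros recip_w_deriv)
    ultimately have "((\<lambda>u. 3 * \<sigma> / a * (cos u * recip_w u)) has_real_derivative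
        3 * \<sigma> / a * (- 2 * (sin u * recip_w u ^ 3))) (at u)"
      by (simp only: DERIV_cmult)
    then show ?thesis by (simp add: mult_ac)
  qed
  have 2: "((\<lambda>u. - 6 * \<sigma> / a\<^sup>2 * (sin u * recip_w u ^ 2)) has_real_derivative
      - 6 * \<sigma> / a\<^sup>2 * (cos u ^ 3 * recip_w u ^ 4)) (at u)" for u
  proof -
    \<comment> \<open>The product rule gives cos u r^4 (1 + sin^2 u - 2 sin^2 u).\<close>
    have "((\<lambda>u. sin u * recip_w u ^ 2) has_real_derivative cos u ^ 3 * recip_w u ^ 4) (at u)"
      by (rule derivative_eq_intros recip_w_deriv refl)+
        (simp only: expand_powers, use recip_w_sq [of u] sin_cos_squared_add [of u] in algebra)
    then show ?thesis by (rule DERIV_cmult)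
  qed
  have "arc_deriv \<gamma> (curvature \<gamma> (\<lambda>u. \<sigma> *\<^sub>R fig_normal u)) =
      (\<lambda>u. - 6 * \<sigma> / a\<^sup>2 * (sin u * recip_w u ^ 2))"
  proof
    fix u
    show "arc_deriv \<gamma> (curvature \<gamma> (\<lambda>u. \<sigma> *\<^sub>R fig_normal u)) u =
        - 6 * \<sigma> / a\<^sup>2 * (sin u * recip_w u ^ 2)"
      using assms(1) recip_w_pos [of u]
      unfolding curvature_scaled_figure_eight [OF assms(1), folded \<gamma>_def, abs_def]
        arc_deriv [OF 1 [unfolded has_real_derivative_iff_has_vector_derivative]]
      by (simp add: field_simps power2_eq_square power3_eq_cube)
  qed
  then have "arc_deriv \<gamma> (arc_deriv \<gamma> (curvature \<gamma> (\<lambda>u. \<sigma> *\<^sub>R fig_normal u))) u =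
      (- 6 * \<sigma> / a\<^sup>2 * (cos u ^ 3 * recip_w u ^ 4)) /\<^sub>R (a * recip_w u)"
    by (simp only: arc_deriv [OF 2 [unfolded has_real_derivative_iff_has_vector_derivative]])
  then show ?thesis
    using assms(1) recip_w_pos [of u]
    by (simp add: fig_frame field_simps eval_nat_numeral)
qed

section \<open>Reduction of the flow to an ordinary differential equation for the scaling
  factor\<close>

text \<open>At time t the scale is a = c f(t), and both sides of the flow equation are multiples of
  the support function: c f' on the left, - 6 / (c f)^3 on the right.\<close>

lemma homothetic_solution_figure_eight_iff:
  assumes "0 < c"
  shows "homothetic_solution (\<lambda>u. c *\<^sub>R figure_eight u) T f \<longleftrightarrow>
    0 < T \<and> f 0 = 1 \<and> (\<forall>t\<in>{0..<T}. 0 < f t \<and>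
      (f has_real_derivative - 6 / (c ^ 4 * f t ^ 3)) (at t within {0..<T}))"
    (is "?L \<longleftrightarrow> ?R")
proof
  assume L: ?L
  have "(f has_real_derivative - 6 / (c ^ 4 * f t ^ 3)) (at t within {0..<T})"
    if t: "t \<in> {0..<T}" for t
  proof -
    let ?a = "f t * c"
    have a: "0 < ?a" using L t assms by (simp add: homothetic_solution_def)
    from L have "curve_diffusion_flow T (\<lambda>u t. (f t * c) *\<^sub>R figure_eight u)"
      by (simp add: homothetic_solution_def)
    from this [unfolded curve_diffusion_flow_def, THEN bspec, OF t] obtain \<nu> where \<nu>: "unit_normal_field (\<lambda>u. ?a *\<^sub>R figure_eight u) \<nu>"
      and flow: "\<And>u. \<exists>V. ((\<lambda>\<tau>. (f \<tau> * c) *\<^sub>R figure_eight u) has_vector_derivative V)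
          (at t within {0..<T}) \<and>
        V \<bullet> \<nu> u = - arc_deriv (\<lambda>u. ?a *\<^sub>R figure_eight u)
          (arc_deriv (\<lambda>u. ?a *\<^sub>R figure_eight u) (curvature (\<lambda>u. ?a *\<^sub>R figure_eight u) \<nu>)) u"
      by blast
    obtain \<sigma> where \<sigma>: "\<sigma>\<^sup>2 = 1" and "\<And>u. \<nu> u = \<sigma> *\<^sub>R fig_normal u"
      using unit_normal_field_unique [OF a \<nu>] by blast
    then have \<nu>_eq: "\<nu> = (\<lambda>u. \<sigma> *\<^sub>R fig_normal u)" by auto
    \<comment> \<open>One point with nonzero support function suffices to extract the equation for
      \<open>f\<close>. At the tip u = 0 the position is the negative of the normal.\<close>
    have zero: "figure_eight 0 = (1, 0)" "fig_normal 0 = (- 1, 0)"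
      by (simp_all add: figure_eight_eq fig_normal_def recip_w_def)
    from flow [of 0] obtain V where
      V: "((\<lambda>\<tau>. (f \<tau> * c) *\<^sub>R figure_eight 0) has_vector_derivative V) (at t within {0..<T})"
      and "V \<bullet> (\<sigma> *\<^sub>R fig_normal 0) = - (6 / ?a ^ 3 * (figure_eight 0 \<bullet> (\<sigma> *\<^sub>R fig_normal 0)))"
      unfolding \<nu>_eq curvature_ss_scaled_figure_eight [OF a] by blast
    then have "\<sigma> * fst V = \<sigma> * (- 6 / ?a ^ 3)"
      by (cases V) (simp add: zero inner_Pair mult.commute minus_equation_iff)
    moreover have "\<sigma> \<noteq> 0" using \<sigma> by auto
    ultimately have "fst V = - 6 / ?a ^ 3" by (rule mult_left_cancel [THEN iffD1, rotated])
    \<comment> \<open>The factor \<open>f\<close> is read off as the first coordinate of the moving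
      tip divided by c.\<close>
    moreover have "((\<lambda>\<tau>. fst ((f \<tau> * c) *\<^sub>R figure_eight 0) / c) has_vector_derivative fst V / c)
        (at t within {0..<T})"
      using bounded_linear.has_vector_derivative
        [OF bounded_linear_compose [OF bounded_linear_divide bounded_linear_fst] V] .
    ultimately show ?thesis
      using assms
      by (simp add: zero has_real_derivative_iff_has_vector_derivative power_mult_distrib
          eval_nat_numeral mult_ac)
  qed
  with L show ?R by (simp add: homothetic_solution_def)
next
  assume R: ?R
  have "\<exists>\<nu>. unit_normal_field (\<lambda>u. f t *\<^sub>R c *\<^sub>R figure_eight u) \<nu> \<and>
      (\<forall>u. \<exists>V. ((\<lambda>\<tau>. f \<tau> *\<^sub>R c *\<^sub>R figure_eight u) has_vector_derivative V) (at t within {0..<T}) \<and>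
        V \<bullet> \<nu> u = - arc_deriv (\<lambda>u. f t *\<^sub>R c *\<^sub>R figure_eight u)
          (arc_deriv (\<lambda>u. f t *\<^sub>R c *\<^sub>R figure_eight u)
            (curvature (\<lambda>u. f t *\<^sub>R c *\<^sub>R figure_eight u) \<nu>)) u)"
    if t: "t \<in> {0..<T}" for t
  proof (intro exI [of _ fig_normal] conjI allI)
    have ft: "0 < f t" using R t by blast
    then have a: "0 < f t * c" using assms by simp
    show "unit_normal_field (\<lambda>u. f t *\<^sub>R c *\<^sub>R figure_eight u) fig_normal"
      using unit_normal_field_fig_normal [of "f t * c"] by simp
    fix u
    \<comment> \<open>The full velocity f'(t) c times the position, with f'(t) taken from the
      differential equation.\<close>
    let ?V = "(- 6 / (c ^ 4 * f t ^ 3)) *\<^sub>R c *\<^sub>R figure_eight u"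
    have "((\<lambda>\<tau>. f \<tau> *\<^sub>R c *\<^sub>R figure_eight u) has_vector_derivative ?V) (at t within {0..<T})"
      using R t by (auto intro!: derivative_eq_intros)
    moreover have "?V \<bullet> fig_normal u = - arc_deriv (\<lambda>u. f t *\<^sub>R c *\<^sub>R figure_eight u)
          (arc_deriv (\<lambda>u. f t *\<^sub>R c *\<^sub>R figure_eight u)
            (curvature (\<lambda>u. f t *\<^sub>R c *\<^sub>R figure_eight u) fig_normal)) u"
      using curvature_ss_scaled_figure_eight [OF a, of 1 u] assms ft
      by (simp add: field_simps eval_nat_numeral)
    ultimately show "\<exists>V. ((\<lambda>\<tau>. f \<tau> *\<^sub>R c *\<^sub>R figure_eight u) has_vector_derivative V)
        (at t within {0..<T}) \<and>
      V \<bullet> fig_normal u = - arc_deriv (\<lambda>u. f t *\<^sub>R c *\<^sub>R figure_eight u)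
          (arc_deriv (\<lambda>u. f t *\<^sub>R c *\<^sub>R figure_eight u)
            (curvature (\<lambda>u. f t *\<^sub>R c *\<^sub>R figure_eight u) fig_normal)) u"
      by blast
  qed
  moreover have "closed_curve (\<lambda>u. f t *\<^sub>R c *\<^sub>R figure_eight u)" if "t \<in> {0..<T}" for t
    using closed_curve_scaled_figure_eight [of "f t * c"] R that assms by simp
  ultimately show ?L
    using R unfolding homothetic_solution_def curve_diffusion_flow_def
    by (auto simp: real_differentiable_def)
qed

text \<open>The derivative of f^4 is 4 f^3 f' = - 24 / c^4, a constant. This explicit integration
  also yields uniqueness of the factor.\<close>

lemma homothetic_factor_power4:
  fixes f :: "real \<Rightarrow> real"
  assumes "c \<noteq> 0" "f 0 = 1" and t: "t \<in> {0..<T}"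
    and f: "\<And>t. t \<in> {0..<T} \<Longrightarrow> 0 < f t"
      "\<And>t. t \<in> {0..<T} \<Longrightarrow> (f has_real_derivative - 6 / (c ^ 4 * f t ^ 3)) (at t within {0..<T})"
  shows "f t ^ 4 = 1 - 24 / c ^ 4 * t"
proof -
  have "((\<lambda>t. f t ^ 4 + 24 / c ^ 4 * t) has_real_derivative 0) (at t within {0..<T})"
    if "t \<in> {0..<T}" for t
  proof -
    show ?thesis
      by (rule DERIV_cong [OF DERIV_add
            [OF DERIV_power [OF f(2) [OF that], of 4] DERIV_cmult_Id [of "24 / c ^ 4"]]])
        (use f(1) [OF that] assms(1) in simp)
  qed
  then obtain k where "\<And>t. t \<in> {0..<T} \<Longrightarrow> f t ^ 4 + 24 / c ^ 4 * t = k"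
    using has_field_derivative_zero_constant
      [of "{0..<T}" "\<lambda>t. f t ^ 4 + 24 / c ^ 4 * t"] by auto
  from this [of 0] this [OF t] show ?thesis using assms(2) t by simp
qed

section \<open>Length of the figure eight\<close>

text \<open>The speed c r is c times the integrand of K(-1). Since r is even and pi-periodic, the
  full period consists of four equal quarters.\<close>

lemma length_figure_eight:
  assumes "0 < c"
  shows "curve_length (\<lambda>u. c *\<^sub>R figure_eight u) = 4 * c * elliptic_K (-1)"
proof -
  let ?K = "elliptic_K (-1)"
  have "continuous_on S recip_w" for S
    by (intro continuous_at_imp_continuous_on ballI DERIV_isCont [OF recip_w_deriv])
  then have "(recip_w has_integral integral {0..pi/2} recip_w) {0..pi/2}"
    by (intro integrable_integral integrable_continuous_real)
  moreover have "integral {0..pi/2} recip_w = ?K"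
    by (simp add: elliptic_K_def recip_w_def [abs_def])
  ultimately have 1: "(recip_w has_integral ?K) {0..pi/2}" by simp
  have shift: "(recip_w has_integral I) {a + pi..b + pi}" if "(recip_w has_integral I) {a..b}" for I a b
    using that has_integral_shift_Icc_real [of recip_w pi I a b]
    by (simp add: recip_w_def [abs_def] o_def add.commute)
  \<comment> \<open>Reflection followed by a shift by pi produces the second quarter.\<close>
  have "(recip_w has_integral ?K) {- (pi/2)..- 0}"
    using has_integral_reflect_lemma_real [OF 1] by (simp add: recip_w_def [abs_def])
  from shift [OF this] have "(recip_w has_integral ?K) {pi/2..pi}" by simp
  from has_integral_combine [OF _ _ 1 this] have 2: "(recip_w has_integral ?K + ?K) {0..pi}" by simp
  from shift [OF this] have "(recip_w has_integral ?K + ?K) {pi..2 * pi}" by simp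
  from has_integral_combine [OF _ _ 2 this]
  have "(recip_w has_integral 4 * ?K) {0..2 * pi}" by simp
  then have "((\<lambda>u. c * recip_w u) has_integral c * (4 * ?K)) {0..2 * pi}"
    by (rule has_integral_mult_right)
  from integral_unique [OF this] show ?thesis
    unfolding curve_length_def speed_scaled_figure_eight [OF assms] by (simp only: ac_simps)
qed

section \<open>Extinction time and uniqueness of the homothetic solution\<close>

text \<open>The clause on \<open>T'\<close> and \<open>g\<close> justifies speaking of "the"
  solution: every competitor is a restriction of \<open>f\<close>, and none can shrink to a point at
  another time.\<close>

theorem mainTheorem9:
  fixes \<gamma> :: "real \<Rightarrow> real \<times> real" and c T :: real
  assumes "0 < c"
    and "\<gamma> = (\<lambda>u. c *\<^sub>R figure_eight u)"
    and "curve_length \<gamma> = 1"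
    and "T = 1 / (3 * 2 ^ 11 * elliptic_K (-1) ^ 4)"
  shows "\<exists>f. homothetic_solution \<gamma> T f \<and> shrinks_to_point_at T f \<and>
           (\<forall>T' g. homothetic_solution \<gamma> T' g \<longrightarrow>
              T' \<le> T \<and> (\<forall>t\<in>{0..<T'}. g t = f t) \<and> (shrinks_to_point_at T' g \<longrightarrow> T' = T))"
proof -
  note hom_iff = homothetic_solution_figure_eight_iff [OF assms(1), folded assms(2)]
  have "4 * c * elliptic_K (-1) = 1"
    using length_figure_eight [OF assms(1)] assms(2,3) by simp
  then have "elliptic_K (-1) = 1 / (4 * c)" using assms(1) by (simp add: field_simps)
  \<comment> \<open>As (4 c)^4 = 2^8 c^4 and 3 * 2^11 / 2^8 = 24, \<open>T\<close> is the zero of 1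
    - 24 t / c^4.\<close>
  then have T: "T = c ^ 4 / 24" using assms(4) by (simp add: power_divide power_mult_distrib)
  have Tpos: "0 < T" unfolding T using assms(1) by simp
  define f where "f = (\<lambda>t. root 4 (1 - t / T))"
  have f4: "f t ^ 4 = 1 - t / T" "0 < f t" if "t < T" for t
    using that Tpos by (simp_all add: f_def)
  have "(f has_real_derivative - 6 / (c ^ 4 * f t ^ 3)) (at t within {0..<T})" if "t \<in> {0..<T}" for t
  proof -
    \<comment> \<open>Derivative of the fourth root by the chain rule; 1 / (4 T) = 6 / c^4 gives the
      required form.\<close>
    have "(f has_real_derivative inverse (4 * f t ^ 3) * (- (1 / T))) (at t within {0..<T})"
      unfolding f_def using that Tpos
      by (auto intro!: derivative_eq_intros simp: field_simps)
    then show ?thesis using f4(2) [of t] that assms(1) by (simp add: T field_simps)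
  qed
  then have sol: "homothetic_solution \<gamma> T f"
    unfolding hom_iff using Tpos f4(2) by (auto simp: f_def)
  have "(f \<longlongrightarrow> root 4 (1 - T / T)) (at_left T)"
    unfolding f_def by (intro tendsto_intros) (use Tpos in auto)
  then have shrinks: "shrinks_to_point_at T f" using Tpos by (simp add: shrinks_to_point_at_def)
  have "T' \<le> T \<and> (\<forall>t\<in>{0..<T'}. g t = f t) \<and> (shrinks_to_point_at T' g \<longrightarrow> T' = T)"
    if "homothetic_solution \<gamma> T' g" for T' g
  proof -
    note g = that [unfolded hom_iff]
    have g4: "g t ^ 4 = 1 - t / T" if "t \<in> {0..<T'}" for t
      using homothetic_factor_power4 [of c g t T'] g that assms(1) by (simp add: T)
    have lt: "t < T" if t: "t \<in> {0..<T'}" for t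
    proof -
      have "0 < g t ^ 4" using g t zero_less_power by blast
      then show ?thesis using g4 [OF t] Tpos by (simp add: field_simps)
    qed
    \<comment> \<open>Otherwise t = T would be an admissible time, and \<open>lt\<close> would give
      T < T.\<close>
    have le: "T' \<le> T"
      using lt [of T] Tpos by force
    have eq: "g t = f t" if t: "t \<in> {0..<T'}" for t
    proof (rule power_eq_imp_eq_base)
      show "g t ^ 4 = f t ^ 4" using g4 [OF t] f4(1) [OF lt [OF t]] by simp
      show "0 \<le> g t" using g t less_imp_le by blast
      show "0 \<le> f t" using f4(2) [OF lt [OF t]] by simp
    qed simp
    have "T' = T" if "shrinks_to_point_at T' g"
    proof -
      \<comment> \<open>The limit of g^4 at T' is 0 by shrinking and 1 - T' / T by the explicit
        formula.\<close>
      have "((\<lambda>t. g t ^ 4) \<longlongrightarrow> 0 ^ 4) (at_left T')"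
        using that unfolding shrinks_to_point_at_def by (rule tendsto_power)
      moreover have "\<forall>\<^sub>F t in at_left T'. g t ^ 4 = 1 - t / T"
        using eventually_at_left_real [of 0 T'] g
        by (auto elim!: eventually_mono intro!: g4)
      ultimately have "((\<lambda>t. 1 - t / T) \<longlongrightarrow> 0) (at_left T')"
        by (simp add: tendsto_cong)
      moreover have "((\<lambda>t. 1 - t / T) \<longlongrightarrow> 1 - T' / T) (at_left T')"
        by (intro tendsto_intros) (use Tpos in auto)
      ultimately have "1 - T' / T = 0"
        by (meson tendsto_unique trivial_limit_at_left_real)
      then show ?thesis using Tpos by simp
    qed
    with le eq show ?thesis by blast
  qed
  with sol shrinks show ?thesis by blast
qed

end
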